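(* Let $k$ be a field, let $\Gamma$ be a permutation group with domain $\Omega$, and let $S=k[x_i]_{i\in\Omega}$. Let $\mathcal{C}=\mathcal{C}(\Gamma,\Omega)$ and let $R=R(\mathcal{C})$ be the associated system of polynomial rings. If $R$ is noetherian then $S$ is $\Gamma$-noetherian.
   Context: The group $\Gamma$ acts on $S$ by $k$-algebra automorphisms permuting variables, $g x_i=x_{gi}$. A $\Gamma$-ideal of $S$ is an ideal stable under $\Gamma$; $S$ is $\Gamma$-noetherian if $\Gamma$-ideals of $S$ satisfy the ascending chain condition. The category $\mathcal{C}(\Gamma,\Omega)$ has as objects the finite subsets of $\Omega$; a morphism $A\to B$ is a function $\phi\colon A\to B$ for which there exists $g\in\Gamma$ with $\phi(x)=gx$ for all $x\in A$. For an object $A$, $R_A=k[x_i]_{i\in A}$; a morphism $\phi\colon A\to B$ induces the $k$-algebra homomorphism $\phi_*\colon R_A\to R_B$, $\phi_*(x_i)=x_{\phi(i)}$. An ideal system in $R$ is a rule assigning to each object $A$ an ideal $I_A$ of $R_A$ such that $\phi_*(I_A)\subset I_B$ for every morphism $\phi\colon A\to B$. Write $I\subset J$ if $I_A\subset J_A$ for all $A$. $R$ is noetherian if ideal systems of $R$ satisfy the ascending chain condition. *)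

theory Defs
  imports "HOL-Algebra.Bij" "HOL-Algebra.RingHom" "HOL-Library.Poly_Mapping"
begin

text \<open>
  A monomial is a finitely supported map from variables to exponents, a polynomial a finitely
  supported map from monomials to coefficients; multiplication on \<open>_ \<Rightarrow>\<^sub>0 _\<close> is convolution.
  The coefficient field \<open>k\<close> is a type of class \<open>field\<close>, passed as a type argument.
\<close>

type_synonym ('v, 'k) mpoly = "('v \<Rightarrow>\<^sub>0 nat) \<Rightarrow>\<^sub>0 'k"

definition const :: "'k \<Rightarrow> ('v, 'k::field) mpoly"
  where "const c = Poly_Mapping.single 0 c"

definition var :: "'v \<Rightarrow> ('v, 'k::field) mpoly"
  where "var i = Poly_Mapping.single (Poly_Mapping.single i 1) 1"

definition mpoly_ring :: "'k::field itself \<Rightarrow> 'v set \<Rightarrow> ('v, 'k) mpoly ring"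
  where "mpoly_ring k A =
    \<lparr>carrier = {f. \<forall>m \<in> Poly_Mapping.keys f. Poly_Mapping.keys m \<subseteq> A},
     monoid.mult = (*), one = 1, ring.zero = 0, add = (+)\<rparr>"

text \<open>
  The \<open>k\<close>-algebra homomorphism \<open>x\<^sub>i \<mapsto> x\<^bsub>\<phi> i\<^esub>\<close>.  On \<open>mpoly_ring k A\<close> it depends only on the values
  of \<open>\<phi>\<close> on \<open>A\<close>.  It gives both the maps of the system \<open>R\<close> and the action of \<open>\<Gamma>\<close> on \<open>S\<close>.
\<close>

definition subst_vars :: "('v \<Rightarrow> 'v) \<Rightarrow> ('v, 'k::field) mpoly \<Rightarrow> ('v, 'k) mpoly"
  where "subst_vars \<phi> f =
    (\<Sum>m \<in> Poly_Mapping.keys f. const (Poly_Mapping.lookup f m) *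
       (\<Prod>i \<in> Poly_Mapping.keys m. var (\<phi> i) ^ Poly_Mapping.lookup m i))"

definition Gamma_ideal ::
    "'k::field itself \<Rightarrow> ('v \<Rightarrow> 'v) set \<Rightarrow> 'v set \<Rightarrow> ('v, 'k) mpoly set \<Rightarrow> bool"
  where "Gamma_ideal k \<Gamma> \<Omega> I \<longleftrightarrow>
    ideal I (mpoly_ring k \<Omega>) \<and> (\<forall>g \<in> \<Gamma>. subst_vars g ` I \<subseteq> I)"

definition Gamma_noetherian :: "'k::field itself \<Rightarrow> ('v \<Rightarrow> 'v) set \<Rightarrow> 'v set \<Rightarrow> bool"
  where "Gamma_noetherian k \<Gamma> \<Omega> \<longleftrightarrow>
    (\<forall>I :: nat \<Rightarrow> ('v, 'k) mpoly set.
       (\<forall>n. Gamma_ideal k \<Gamma> \<Omega> (I n)) \<and> (\<forall>n. I n \<subseteq> I (Suc n)) \<longrightarrow>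
       (\<exists>N. \<forall>n \<ge> N. I n = I N))"

definition C_objects :: "'v set \<Rightarrow> 'v set set"
  where "C_objects \<Omega> = {A. A \<subseteq> \<Omega> \<and> finite A}"

definition C_morphisms :: "('v \<Rightarrow> 'v) set \<Rightarrow> 'v set \<Rightarrow> 'v set \<Rightarrow> ('v \<Rightarrow> 'v) set"
  where "C_morphisms \<Gamma> A B = {\<phi> \<in> A \<rightarrow>\<^sub>E B. \<exists>g \<in> \<Gamma>. \<forall>x \<in> A. \<phi> x = g x}"

definition ideal_system ::
    "'k::field itself \<Rightarrow> ('v \<Rightarrow> 'v) set \<Rightarrow> 'v set \<Rightarrow> ('v set \<Rightarrow> ('v, 'k) mpoly set) \<Rightarrow> bool"
  where "ideal_system k \<Gamma> \<Omega> I \<longleftrightarrow>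
    (\<forall>A \<in> C_objects \<Omega>. ideal (I A) (mpoly_ring k A)) \<and>
    (\<forall>A \<in> C_objects \<Omega>. \<forall>B \<in> C_objects \<Omega>. \<forall>\<phi> \<in> C_morphisms \<Gamma> A B. subst_vars \<phi> ` I A \<subseteq> I B)"

text \<open>
  An ideal system is a total function here, but only its values on objects matter, so systems
  are compared on objects only.
\<close>

definition system_noetherian :: "'k::field itself \<Rightarrow> ('v \<Rightarrow> 'v) set \<Rightarrow> 'v set \<Rightarrow> bool"
  where "system_noetherian k \<Gamma> \<Omega> \<longleftrightarrow>
    (\<forall>I :: nat \<Rightarrow> 'v set \<Rightarrow> ('v, 'k) mpoly set.
       (\<forall>n. ideal_system k \<Gamma> \<Omega> (I n)) \<and> (\<forall>n. \<forall>A \<in> C_objects \<Omega>. I n A \<subseteq> I (Suc n) A) \<longrightarrow>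
       (\<exists>N. \<forall>n \<ge> N. \<forall>A \<in> C_objects \<Omega>. I n A = I N A))"

lemma in_carrier_iff:
  "f \<in> carrier (mpoly_ring k A) \<longleftrightarrow> (\<forall>m \<in> Poly_Mapping.keys f. Poly_Mapping.keys m \<subseteq> A)"
  by (simp add: mpoly_ring_def)

lemma carrier_closed:
  assumes "f \<in> carrier (mpoly_ring k A)" "g \<in> carrier (mpoly_ring k A)"
  shows "f + g \<in> carrier (mpoly_ring k A)" "f * g \<in> carrier (mpoly_ring k A)"
    "- f \<in> carrier (mpoly_ring k A)"
proof -
  show "f + g \<in> carrier (mpoly_ring k A)"
    using assms Poly_Mapping.keys_add[of f g] unfolding in_carrier_iff by blast
  show "- f \<in> carrier (mpoly_ring k A)"
    using assms by (simp add: in_carrier_iff)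
  show "f * g \<in> carrier (mpoly_ring k A)"
    unfolding in_carrier_iff
  proof
    fix m assume "m \<in> Poly_Mapping.keys (f * g)"
    then obtain a b where "m = a + b" "a \<in> Poly_Mapping.keys f" "b \<in> Poly_Mapping.keys g"
      using Poly_Mapping.keys_mult[of f g] by blast
    then show "Poly_Mapping.keys m \<subseteq> A"
      using assms Poly_Mapping.keys_add[of a b] unfolding in_carrier_iff by blast
  qed
qed

lemma const_in_carrier: "const c \<in> carrier (mpoly_ring k A)"
  by (simp add: in_carrier_iff const_def)

lemma var_in_carrier: "i \<in> A \<Longrightarrow> var i \<in> carrier (mpoly_ring k A)"
  by (simp add: in_carrier_iff var_def)

lemma mpoly_ring_simps [simp]:
  "\<zero>\<^bsub>mpoly_ring k A\<^esub> = 0" "\<one>\<^bsub>mpoly_ring k A\<^esub> = 1"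
  "x \<oplus>\<^bsub>mpoly_ring k A\<^esub> y = x + y" "x \<otimes>\<^bsub>mpoly_ring k A\<^esub> y = x * y"
  by (simp_all add: mpoly_ring_def)

lemma zero_one_in_carrier:
  "0 \<in> carrier (mpoly_ring k A)" "1 \<in> carrier (mpoly_ring k A)"
  by (simp_all add: in_carrier_iff)

lemma cring_mpoly_ring: "cring (mpoly_ring k A)"
proof (rule cringI)
  show "abelian_group (mpoly_ring k A)"
  proof (rule abelian_groupI)
    fix x assume "x \<in> carrier (mpoly_ring k A)"
    then show "\<exists>y\<in>carrier (mpoly_ring k A). y \<oplus>\<^bsub>mpoly_ring k A\<^esub> x = \<zero>\<^bsub>mpoly_ring k A\<^esub>"
      by (intro bexI[of _ "- x"]) (simp_all add: carrier_closed(3))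
  qed (simp_all add: carrier_closed zero_one_in_carrier ac_simps)
  show "comm_monoid (mpoly_ring k A)"
    by (rule comm_monoidI) (simp_all add: carrier_closed zero_one_in_carrier ac_simps)
qed (simp add: algebra_simps)

definition subst_monom :: "('v \<Rightarrow> 'v) \<Rightarrow> ('v \<Rightarrow>\<^sub>0 nat) \<Rightarrow> ('v, 'k::field) mpoly"
  where "subst_monom \<phi> m =
    (\<Prod>i \<in> Poly_Mapping.keys m. var (\<phi> i) ^ Poly_Mapping.lookup m i)"

lemma subst_monom_superset:
  assumes "finite X" "Poly_Mapping.keys m \<subseteq> X"
  shows "subst_monom \<phi> m = (\<Prod>i \<in> X. var (\<phi> i) ^ Poly_Mapping.lookup m i)"
  unfolding subst_monom_def using assms
  by (intro prod.mono_neutral_left) (auto simp: Poly_Mapping.in_keys_iff)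

lemma subst_monom_add: "subst_monom \<phi> (m + n) = subst_monom \<phi> m * subst_monom \<phi> n"
proof -
  let ?X = "Poly_Mapping.keys m \<union> Poly_Mapping.keys n"
  have X: "finite ?X" "Poly_Mapping.keys (m + n) \<subseteq> ?X"
    using Poly_Mapping.keys_add[of m n] by auto
  show ?thesis
    by (simp add: subst_monom_superset[OF X] subst_monom_superset[OF X(1), of m]
        subst_monom_superset[OF X(1), of n] lookup_add power_add prod.distrib)
qed

lemma const_simps:
  "const 0 = 0" "const 1 = 1" "const (a + b) = const a + const b" "const (a * b) = const a * const b"
  by (simp_all add: const_def single_add mult_single)

lemma subst_vars_alt:
  "subst_vars \<phi> f = (\<Sum>m \<in> Poly_Mapping.keys f. const (Poly_Mapping.lookup f m) * subst_monom \<phi> m)"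
  by (simp add: subst_vars_def subst_monom_def)

lemma subst_vars_add: "subst_vars \<phi> (f + g) = subst_vars \<phi> f + subst_vars \<phi> g"
  unfolding subst_vars_alt
  by (rule Poly_Mapping.setsum_keys_plus_distrib) (simp_all add: const_simps algebra_simps)

lemma subst_vars_single: "subst_vars \<phi> (Poly_Mapping.single m c) = const c * subst_monom \<phi> m"
  by (simp add: subst_vars_alt const_simps)

lemma subst_vars_zero: "subst_vars \<phi> 0 = 0"
  by (simp add: subst_vars_alt)

lemma subst_vars_sum: "subst_vars \<phi> (sum h X) = (\<Sum>x \<in> X. subst_vars \<phi> (h x))"
  by (induction X rule: infinite_finite_induct) (simp_all add: subst_vars_add subst_vars_zero)

lemma mpoly_expand: "f = (\<Sum>m \<in> Poly_Mapping.keys f. Poly_Mapping.single m (Poly_Mapping.lookup f m))"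
  by (rule poly_mapping_eqI)
    (simp add: lookup_sum lookup_single when_def Poly_Mapping.in_keys_iff)

lemma subst_vars_mult: "subst_vars \<phi> (f * g) = subst_vars \<phi> f * subst_vars \<phi> g"
proof -
  have "f * g = (\<Sum>m \<in> Poly_Mapping.keys f. \<Sum>n \<in> Poly_Mapping.keys g.
      Poly_Mapping.single (m + n) (Poly_Mapping.lookup f m * Poly_Mapping.lookup g n))"
    using arg_cong2[OF mpoly_expand[of f] mpoly_expand[of g], of "(*)"]
    unfolding sum_product mult_single .
  then have "subst_vars \<phi> (f * g) = (\<Sum>m \<in> Poly_Mapping.keys f. \<Sum>n \<in> Poly_Mapping.keys g.
      (const (Poly_Mapping.lookup f m) * subst_monom \<phi> m) *
      (const (Poly_Mapping.lookup g n) * subst_monom \<phi> n))"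
    by (simp add: subst_vars_sum subst_vars_single const_simps subst_monom_add ac_simps)
  then show ?thesis
    by (simp add: subst_vars_alt sum_product)
qed

lemma subst_vars_const: "subst_vars \<phi> (const c) = const c"
  unfolding const_def[of c] subst_vars_single by (simp add: subst_monom_def const_def)

lemma subst_vars_var: "subst_vars \<phi> (var i) = var (\<phi> i)"
  unfolding var_def[of i] subst_vars_single by (simp add: subst_monom_def const_simps)

lemma subst_vars_closed:
  assumes "f \<in> carrier (mpoly_ring k A)" "\<phi> ` A \<subseteq> B"
  shows "subst_vars \<phi> f \<in> carrier (mpoly_ring k B)"
proof -
  note zero_one = zero_one_in_carrier[of k B]
  have pow: "var j ^ n \<in> carrier (mpoly_ring k B)" if "j \<in> B" for j n
    by (induction n) (simp_all add: zero_one carrier_closed var_in_carrier that)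
  have prod: "prod h X \<in> carrier (mpoly_ring k B)"
    if "\<And>x. x \<in> X \<Longrightarrow> h x \<in> carrier (mpoly_ring k B)" for h and X :: "'a set"
    using that by (induction X rule: infinite_finite_induct) (simp_all add: zero_one carrier_closed)
  have sum: "sum h X \<in> carrier (mpoly_ring k B)"
    if "\<And>x. x \<in> X \<Longrightarrow> h x \<in> carrier (mpoly_ring k B)" for h and X :: "('a \<Rightarrow>\<^sub>0 nat) set"
    using that by (induction X rule: infinite_finite_induct) (simp_all add: zero_one carrier_closed)
  show ?thesis
    unfolding subst_vars_def
    using assms by (intro sum carrier_closed(2) const_in_carrier prod pow) (auto simp: in_carrier_iff)
qed

lemma subst_vars_ring_hom:
  assumes "\<phi> ` A \<subseteq> B"
  shows "subst_vars \<phi> \<in> ring_hom (mpoly_ring k A) (mpoly_ring k B)"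
proof (rule ring_hom_memI)
  fix f assume "f \<in> carrier (mpoly_ring k A)"
  then show "subst_vars \<phi> f \<in> carrier (mpoly_ring k B)"
    using assms by (rule subst_vars_closed)
next
  show "subst_vars \<phi> \<one>\<^bsub>mpoly_ring k A\<^esub> = \<one>\<^bsub>mpoly_ring k B\<^esub>"
    using subst_vars_const[of \<phi> 1] by (simp add: const_simps(2))
qed (simp_all add: subst_vars_add subst_vars_mult)

end

theory Submission
  imports Defs "HOL-Algebra.QuotRing"
begin

text \<open>
  A polynomial involves only finitely many variables, so an ideal \<open>I\<close> of \<open>S\<close> is the union of its
  contractions \<open>I \<inter> R\<^sub>A\<close> to the polynomial rings on the finite sets \<open>A \<subseteq> \<Omega>\<close>
  (\<open>Un_contractions\<close>).  When \<open>I\<close> is a \<open>\<Gamma>\<close>-ideal, these contractions form an ideal system, because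
  each morphism is the restriction of some \<open>g \<in> \<Gamma>\<close> and so induces on \<open>R\<^sub>A\<close> the action of \<open>g\<close>
  (\<open>ideal_system_contraction\<close>).  An ascending chain of \<open>\<Gamma>\<close>-ideals thus contracts to an ascending
  chain of ideal systems; the latter stabilizes, and the former is recovered from it by taking
  unions, so it stabilizes at the same index.
\<close>

lemma mpoly_ring_carrier_mono:
  "A \<subseteq> B \<Longrightarrow> carrier (mpoly_ring k A) \<subseteq> carrier (mpoly_ring k B)"
  unfolding subset_iff in_carrier_iff by blast

lemma subst_vars_cong:
  assumes "f \<in> carrier (mpoly_ring k A)" "\<And>x. x \<in> A \<Longrightarrow> \<phi> x = \<psi> x"
  shows "subst_vars \<phi> f = subst_vars \<psi> f"
proof -
  have "\<phi> i = \<psi> i" if "m \<in> Poly_Mapping.keys f" "i \<in> Poly_Mapping.keys m" for m i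
    using assms that by (auto simp: in_carrier_iff)
  then show ?thesis
    by (simp add: subst_vars_def)
qed

text \<open>
  The contraction is the preimage of \<open>I\<close> under the inclusion of rings.
\<close>
lemma ideal_contraction:
  assumes "ideal I (mpoly_ring k B)" "A \<subseteq> B"
  shows "ideal (I \<inter> carrier (mpoly_ring k A)) (mpoly_ring k A)"
proof -
  have ring: "ring (mpoly_ring k C)" for C
    using cring_mpoly_ring by (rule cring.axioms)
  have "id \<in> ring_hom (mpoly_ring k A) (mpoly_ring k B)"
    using mpoly_ring_carrier_mono[OF assms(2), of k] by (intro ring_hom_memI) auto
  then interpret incl: ring_hom_ring "mpoly_ring k A" "mpoly_ring k B" id
    by (intro ring_hom_ringI2 ring)
  have "I \<inter> carrier (mpoly_ring k A) = {r \<in> carrier (mpoly_ring k A). id r \<in> I}"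
    by auto
  then show ?thesis
    using incl.ideal_vimage[OF assms(1)] by simp
qed

lemma carrier_finite_support:
  assumes "f \<in> carrier (mpoly_ring k \<Omega>)"
  shows "\<exists>A \<in> C_objects \<Omega>. f \<in> carrier (mpoly_ring k A)"
proof
  show "(\<Union>m \<in> Poly_Mapping.keys f. Poly_Mapping.keys m) \<in> C_objects \<Omega>"
    using assms by (auto simp: in_carrier_iff C_objects_def)
qed (auto simp: in_carrier_iff)

lemma Un_contractions:
  assumes "ideal I (mpoly_ring k \<Omega>)"
  shows "I = (\<Union>A \<in> C_objects \<Omega>. I \<inter> carrier (mpoly_ring k A))"
  using carrier_finite_support ideal.Icarr[OF assms] by blast

lemma ideal_system_contraction:
  assumes I: "Gamma_ideal k \<Gamma> \<Omega> I"
  shows "ideal_system k \<Gamma> \<Omega> (\<lambda>A. I \<inter> carrier (mpoly_ring k A))"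
  unfolding ideal_system_def
proof (intro conjI ballI)
  fix A assume "A \<in> C_objects \<Omega>"
  then show "ideal (I \<inter> carrier (mpoly_ring k A)) (mpoly_ring k A)"
    using I by (intro ideal_contraction[of I k \<Omega>]) (auto simp: Gamma_ideal_def C_objects_def)
next
  fix A B \<phi> assume \<phi>: "\<phi> \<in> C_morphisms \<Gamma> A B"
  then obtain g where g: "g \<in> \<Gamma>" "\<And>x. x \<in> A \<Longrightarrow> \<phi> x = g x"
    unfolding C_morphisms_def by blast
  have AB: "\<phi> ` A \<subseteq> B"
    using \<phi> by (auto simp: C_morphisms_def)
  show "subst_vars \<phi> ` (I \<inter> carrier (mpoly_ring k A)) \<subseteq> I \<inter> carrier (mpoly_ring k B)"
  proof clarify
    fix f assume f: "f \<in> I" "f \<in> carrier (mpoly_ring k A)"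
    have "subst_vars \<phi> f = subst_vars g f"
      using f(2) g(2) by (rule subst_vars_cong)
    then have "subst_vars \<phi> f \<in> I"
      using I g(1) f(1) by (auto simp: Gamma_ideal_def)
    then show "subst_vars \<phi> f \<in> I \<inter> carrier (mpoly_ring k B)"
      using subst_vars_closed[OF f(2) AB] by blast
  qed
qed

theorem theorem3p1:
  fixes k :: "'k::field itself"
    and \<Omega> :: "'v set"
    and \<Gamma> :: "('v \<Rightarrow> 'v) set"
  assumes "subgroup \<Gamma> (BijGroup \<Omega>)"
    and "system_noetherian k \<Gamma> \<Omega>"
  shows "Gamma_noetherian k \<Gamma> \<Omega>"
  unfolding Gamma_noetherian_def
proof (intro allI impI)
  fix I :: "nat \<Rightarrow> ('v, 'k) mpoly set"
  assume I: "(\<forall>n. Gamma_ideal k \<Gamma> \<Omega> (I n)) \<and> (\<forall>n. I n \<subseteq> I (Suc n))"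
  define J where "J n A = I n \<inter> carrier (mpoly_ring k A)" for n A
  have "\<forall>n. ideal_system k \<Gamma> \<Omega> (J n)"
    unfolding J_def using I ideal_system_contraction by blast
  moreover have "\<forall>n. \<forall>A \<in> C_objects \<Omega>. J n A \<subseteq> J (Suc n) A"
    unfolding J_def using I by blast
  ultimately obtain N where N: "\<forall>n \<ge> N. \<forall>A \<in> C_objects \<Omega>. J n A = J N A"
    using assms(2)[unfolded system_noetherian_def, THEN spec, of J] by blast
  have union: "I n = (\<Union>A \<in> C_objects \<Omega>. J n A)" for n
    unfolding J_def using I by (intro Un_contractions) (simp add: Gamma_ideal_def)
  show "\<exists>N. \<forall>n \<ge> N. I n = I N"
  proof (intro exI allI impI)
    fix n assume "n \<ge> N"
    then show "I n = I N"
      unfolding union using N by (intro SUP_cong refl) blast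
  qed
qed

end
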